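(* Let $n$, $m$ and $t$ be positive integers with $m\le \left\lfloor \frac{n}{t+1}\right\rfloor$. Then $$p^{(t)}(n,m)=1+\sum_{k=m}^{\left\lfloor \frac{n}{t+1}\right\rfloor} p^{(t)}(n-k,k).$$
   Context: A partition of a positive integer $n$ is a finite sequence $\lambda=[\lambda_1,\ldots,\lambda_k]$ of positive integers with $\lambda_1\ge\cdots\ge\lambda_k$ and $\lambda_1+\cdots+\lambda_k=n$; we write $\lambda\vdash n$. For positive integers $n,m,t$, $p^{(t)}(n,m)$ denotes the number of partitions $\lambda\vdash n$ all of whose parts are at least $m$ and which satisfy $\lambda_1\ge t\cdot\lambda_2$. The one-part partition $[n]$ is considered to satisfy this condition, so it is counted whenever $n\ge m$. *)

theory Defs
  imports Main
begin

definition is_partition :: "nat list \<Rightarrow> nat \<Rightarrow> bool" where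
  "is_partition xs n \<longleftrightarrow>
     sorted_wrt (\<ge>) xs \<and> (\<forall>x \<in> set xs. 0 < x) \<and> sum_list xs = n"

text \<open>Lists are indexed from 0, so the first two parts are \<open>xs ! 0\<close> and \<open>xs ! 1\<close>;
  a partition with a single part satisfies the gap condition vacuously.\<close>

definition gap_partitions :: "nat \<Rightarrow> nat \<Rightarrow> nat \<Rightarrow> nat list set" where
  "gap_partitions t n m =
     {xs. is_partition xs n \<and> (\<forall>x \<in> set xs. m \<le> x) \<and>
          (2 \<le> length xs \<longrightarrow> t * xs ! 1 \<le> xs ! 0)}"

definition num_gap_partitions :: "nat \<Rightarrow> nat \<Rightarrow> nat \<Rightarrow> nat" where
  "num_gap_partitions t n m = card (gap_partitions t n m)"

lemma finite_gap_partitions: "finite (gap_partitions t n m)"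
proof (rule finite_subset)
  have "length xs \<le> sum_list xs" if "\<forall>x \<in> set xs. 0 < x" for xs :: "nat list"
    using that by (induction xs) auto
  then show "gap_partitions t n m \<subseteq> {xs. set xs \<subseteq> {..n} \<and> length xs \<le> n}"
    by (auto simp: gap_partitions_def is_partition_def dest: member_le_sum_list)
  show "finite {xs. set xs \<subseteq> {..n} \<and> length xs \<le> n}"
    by (rule finite_lists_length_le) simp
qed

end

theory Submission
  imports Defs
begin

text \<open>Removing the smallest part \<open>k\<close> of a partition with at least two parts is a bijection onto the
  pairs of some \<open>k\<close> with \<open>m \<le> k \<le> n div (t + 1)\<close> and a partition counted by \<open>p\<^sup>(\<^sup>t\<^sup>)(n - k, k)\<close>.
  The upper bound on \<open>k\<close> follows from \<open>n \<ge> \<lambda>\<^sub>1 + k \<ge> t \<lambda>\<^sub>2 + k \<ge> (t + 1) k\<close>; conversely, it is exactly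
  what makes the two-part partition \<open>[n - k, k]\<close> admissible.\<close>

text \<open>The new entry \<open>k\<close> is the second part only when \<open>ys = [n - k]\<close>,
  and the gap condition then reads \<open>t * k \<le> n - k\<close>, which is \<open>bound\<close>.
  For longer \<open>ys\<close> the first two parts stay the same.\<close>

lemma append_last_in_gap_partitions:
  assumes "0 < m" and "m \<le> k" and bound: "t * k + k \<le> n" and "ys \<noteq> []"
    and ys: "ys \<in> gap_partitions t (n - k) k"
  shows "ys @ [k] \<in> gap_partitions t n m"
proof -
  have "t * (ys @ [k]) ! 1 \<le> (ys @ [k]) ! 0"
  proof (cases "length ys = 1")
    case True
    then obtain a where "ys = [a]"
      by (auto simp: length_Suc_conv)
    then show ?thesis
      using ys bound by (auto simp: gap_partitions_def is_partition_def)
  next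
    case False
    then have "2 \<le> length ys"
      using \<open>ys \<noteq> []\<close> by (cases ys) (auto simp: Suc_le_eq)
    then show ?thesis
      using ys by (auto simp: gap_partitions_def nth_append)
  qed
  then show ?thesis
    using assms by (fastforce simp: gap_partitions_def is_partition_def sorted_wrt_append)
qed

text \<open>Since the parts decrease weakly, all those before the last are at least
  \<open>k\<close>; so the lower bound rises from \<open>m\<close> to \<open>k\<close>.\<close>

lemma butlast_in_gap_partitions:
  assumes "ys @ [k] \<in> gap_partitions t n m" and "ys \<noteq> []"
  shows "ys \<in> gap_partitions t (n - k) k" and "m \<le> k" and "t * k + k \<le> n"
proof -
  obtain a zs where ys: "ys = a # zs"
    using assms(2) by (cases ys) auto
  \<comment> \<open>\<open>(zs @ [k]) ! 0\<close> is the second part, whether or not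
    \<open>zs\<close> is empty.\<close>
  have gap: "t * (zs @ [k]) ! 0 \<le> a"
    using assms(1) by (auto simp: ys gap_partitions_def)
  show "ys \<in> gap_partitions t (n - k) k"
    using assms(1) gap
    by (cases zs) (auto simp: ys gap_partitions_def is_partition_def sorted_wrt_append)
  show "m \<le> k"
    using assms(1) by (auto simp: gap_partitions_def)
  have "k \<le> (zs @ [k]) ! 0"
    using assms(1) by (cases zs) (auto simp: ys gap_partitions_def is_partition_def sorted_wrt_append)
  then have "t * k \<le> a"
    using gap le_trans mult_le_mono2 by blast
  then show "t * k + k \<le> n"
    using assms(1) by (auto simp: ys gap_partitions_def is_partition_def)
qed

lemma gap_partitions_decompose:
  assumes "0 < m" and "0 < t" and "m \<le> n"
  shows "gap_partitions t n m =
    insert [n] (\<Union>k\<in>{m..n div (t + 1)}. (\<lambda>ys. ys @ [k]) ` gap_partitions t (n - k) k)"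
    (is "?L = insert [n] ?R")
proof
  show "?L \<subseteq> insert [n] ?R"
  proof
    fix xs assume xs: "xs \<in> ?L"
    then have "xs \<noteq> []"
      using assms by (auto simp: gap_partitions_def is_partition_def)
    then obtain ys k where xs_eq: "xs = ys @ [k]"
      by (cases xs rule: rev_cases) auto
    show "xs \<in> insert [n] ?R"
    proof (cases "ys = []")
      case True
      then show ?thesis
        using xs by (auto simp: xs_eq gap_partitions_def is_partition_def)
    next
      case False
      note * = butlast_in_gap_partitions[OF xs[unfolded xs_eq] False]
      have "k \<le> n div (t + 1)"
        using *(3) by (simp add: less_eq_div_iff_mult_less_eq algebra_simps)
      then show ?thesis
        using *(1,2) by (auto simp: xs_eq)
    qed
  qed
  show "insert [n] ?R \<subseteq> ?L"
  proof
    fix xs assume "xs \<in> insert [n] ?R"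
    then consider "xs = [n]"
      | k ys where "xs = ys @ [k]" "m \<le> k" "k \<le> n div (t + 1)" "ys \<in> gap_partitions t (n - k) k"
      by auto
    then show "xs \<in> ?L"
    proof cases
      case 1
      then show ?thesis
        using assms by (auto simp: gap_partitions_def is_partition_def)
    next
      case 2
      have bound: "t * k + k \<le> n"
        using 2(3) by (simp add: less_eq_div_iff_mult_less_eq algebra_simps)
      \<comment> \<open>This makes \<open>n - k\<close> positive and so rules out
        \<open>ys = []\<close>, the empty partition of 0.\<close>
      moreover have "0 < t * k"
        using assms 2(2) by simp
      ultimately have "0 < n - k"
        by linarith
      then have "ys \<noteq> []"
        using 2(4) by (auto simp: gap_partitions_def is_partition_def)
      then show ?thesis
        using append_last_in_gap_partitions[OF assms(1) 2(2) bound _ 2(4)] 2(1) by simp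
    qed
  qed
qed

theorem theorem2:
  fixes n m t :: nat
  assumes "0 < n" and "0 < m" and "0 < t"
    and "m \<le> n div (t + 1)"
  shows "num_gap_partitions t n m = 1 + (\<Sum>k = m..n div (t + 1). num_gap_partitions t (n - k) k)"
proof -
  let ?A = "\<lambda>k. (\<lambda>ys. ys @ [k]) ` gap_partitions t (n - k) k"
  let ?U = "\<Union>k\<in>{m..n div (t + 1)}. ?A k"
  have "m \<le> n"
    using assms(4) div_le_dividend le_trans by blast
  \<comment> \<open>\<open>ys @ [k] = [n]\<close> would force \<open>k = n\<close>, beyond the range
    of the union.\<close>
  have "n div (t + 1) < n"
    using assms by (intro div_less_dividend) auto
  then have "[n] \<notin> ?U"
    by auto
  moreover have "finite ?U"
    by (auto simp: finite_gap_partitions)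
  \<comment> \<open>The sets \<open>?A k\<close> are disjoint because the last entry of a list in
    \<open>?A k\<close> is \<open>k\<close>.\<close>
  moreover have "card ?U = (\<Sum>k = m..n div (t + 1). card (?A k))"
    by (rule card_UN_disjoint) (auto simp: finite_gap_partitions)
  moreover have "card (?A k) = num_gap_partitions t (n - k) k" for k
    unfolding num_gap_partitions_def by (rule card_image) (simp add: inj_on_def)
  ultimately show ?thesis
    unfolding num_gap_partitions_def[of t n m]
      gap_partitions_decompose[OF assms(2,3) \<open>m \<le> n\<close>]
    by simp
qed

end
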